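(* Let $K$ be a compact Polish space and let $Z=\{Z(y):y\in K\}$ be a max-stable process with a normalized spectral representation $$Z=^d\max_{t\in\Pi_0} tF^*_t,\qquad \sup_{y\in K}F^*(y)\equiv c\in(0,\infty).$$ Let $Z^K:=\sup_{y\in K}Z(y)$. Then: 1. $c=-\log\mathbb{P}(Z^K\le 1)$. 2. For any $n\in\mathbb{N}$, $y_1,\dots,y_n\in K$ and $w_1,\dots,w_n>0$, $$\mathbb{P}\big(F^*(y_i)\le w_i,\ 1\le i\le n\big)=\lim_{z\to\infty}\mathbb{P}\Big(\frac{Z(y_i)}{Z^K}\le\frac{w_i}{c},\ 1\le i\le n\ \Big|\ Z^K>z\Big).$$
   Context: Normalized spectral representation: $\Pi_0$ is a Poisson point process on $(0,\infty)$ with intensity $t^{-2}\,\mathrm{d}t$, and $F^*_t$, $t>0$, are independent copies (also independent of $\Pi_0$) of a stochastic process $F^*=\{F^*(y):y\in K\}$ with values in $[0,\infty)$ satisfying $\sup_{y\in K}F^*(y)\equiv c$ for some constant $c\in(0,\infty)$. The right-hand side $\max_{t\in\Pi_0}tF^*_t$ (pointwise supremum over $y\in K$) is then called a normalized spectral representation of $Z$. Max-stable processes are taken with standard Fréchet margins. Suprema over $K$ are assumed measurable, and $=^d$ is understood as equality in law on the path space including the supremum over $K$, i.e. $Z^K$ together with the finite-dimensional marginals of $Z$ has the same joint law as the corresponding quantities for $\max_{t\in\Pi_0}tF^*_t$. *)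

theory Defs
  imports "HOL-Probability.Probability"
begin

section \<open>Processes, paths and laws\<close>

text \<open>A process indexed by \<open>K\<close> is a map \<open>X :: 'w \<Rightarrow> 'k \<Rightarrow> _\<close>; only its values at indices in \<open>K\<close> matter.
  Suprema over \<open>K\<close> are taken in \<^typ>\<open>ereal\<close>, so that they are meaningful without any
  boundedness assumption on the paths.\<close>

definition path_sup :: "'k set \<Rightarrow> ('w \<Rightarrow> 'k \<Rightarrow> ereal) \<Rightarrow> 'w \<Rightarrow> ereal" where
  "path_sup K X \<omega> = (SUP y\<in>K. X \<omega> y)"

definition sup_path :: "'k set \<Rightarrow> ('w \<Rightarrow> 'k \<Rightarrow> ereal) \<Rightarrow> 'w \<Rightarrow> ('k \<Rightarrow> ereal) \<times> ereal" where
  "sup_path K X \<omega> = (restrict (X \<omega>) K, path_sup K X \<omega>)"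

definition path_space :: "'k set \<Rightarrow> (('k \<Rightarrow> ereal) \<times> ereal) measure" where
  "path_space K = PiM K (\<lambda>_. borel) \<Otimes>\<^sub>M borel"

text \<open>For uncountable \<open>K\<close> the supremum is not measurable for the product \<open>\<sigma>\<close>-algebra, so its
  measurability is a requirement of its own.\<close>

definition sup_process :: "'w measure \<Rightarrow> 'k set \<Rightarrow> ('w \<Rightarrow> 'k \<Rightarrow> ereal) \<Rightarrow> bool" where
  "sup_process M K X \<longleftrightarrow> prob_space M \<and>
     (\<forall>y\<in>K. (\<lambda>\<omega>. X \<omega> y) \<in> borel_measurable M) \<and>
     path_sup K X \<in> borel_measurable M"

text \<open>Law on the path space including the supremum over \<open>K\<close>: equality of \<open>sup_law\<close> is equality of
  all joint laws of finitely many marginals together with the supremum.\<close>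

definition sup_law :: "'w measure \<Rightarrow> 'k set \<Rightarrow> ('w \<Rightarrow> 'k \<Rightarrow> ereal) \<Rightarrow> (('k \<Rightarrow> ereal) \<times> ereal) measure" where
  "sup_law M K X = distr M (path_space K) (sup_path K X)"


section \<open>Max-stable processes with standard Frechet margins\<close>

definition fdd_law :: "'w measure \<Rightarrow> 'k set \<Rightarrow> ('w \<Rightarrow> 'k \<Rightarrow> real) \<Rightarrow> ('k \<Rightarrow> real) measure" where
  "fdd_law M K X = distr M (PiM K (\<lambda>_. borel)) (\<lambda>\<omega>. restrict (X \<omega>) K)"

text \<open>With standard Frechet margins the norming functions are forced: the pointwise maximum of
  \<open>n\<close> independent copies of \<open>Z\<close> has the law of \<open>n Z\<close>. The copies are realised canonically on the
  \<open>n\<close>-fold product of the law of \<open>Z\<close>.\<close>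

definition max_stable_process :: "'w measure \<Rightarrow> 'k set \<Rightarrow> ('w \<Rightarrow> 'k \<Rightarrow> real) \<Rightarrow> bool" where
  "max_stable_process M K Z \<longleftrightarrow> prob_space M \<and>
     (\<forall>y\<in>K. (\<lambda>\<omega>. Z \<omega> y) \<in> borel_measurable M) \<and>
     (\<forall>y\<in>K. \<forall>x>0. \<P>(\<omega> in M. Z \<omega> y \<le> x) = exp (- 1 / x)) \<and>
     (\<forall>n::nat. n \<ge> 1 \<longrightarrow>
        fdd_law (PiM {..<n} (\<lambda>_. fdd_law M K Z)) K (\<lambda>\<zeta> y. MAX i\<in>{..<n}. \<zeta> i y)
        = fdd_law M K (\<lambda>\<omega> y. real n * Z \<omega> y))"


section \<open>Poisson point processes\<close>

definition point_count :: "('w \<Rightarrow> 'a set) \<Rightarrow> 'a set \<Rightarrow> 'w \<Rightarrow> ennreal" where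
  "point_count \<Pi>\<^sub>0 A \<omega> = emeasure (count_space UNIV) (\<Pi>\<^sub>0 \<omega> \<inter> A)"

definition poisson_point_process :: "'w measure \<Rightarrow> 'a measure \<Rightarrow> ('w \<Rightarrow> 'a set) \<Rightarrow> bool" where
  "poisson_point_process M \<mu> \<Pi>\<^sub>0 \<longleftrightarrow> prob_space M \<and>
     (\<forall>\<omega>\<in>space M. \<Pi>\<^sub>0 \<omega> \<subseteq> space \<mu>) \<and>
     (\<forall>A\<in>sets \<mu>. point_count \<Pi>\<^sub>0 A \<in> borel_measurable M) \<and>
     (\<forall>A\<in>sets \<mu>. emeasure \<mu> A < \<infinity> \<longrightarrow> (\<forall>k::nat.
        \<P>(\<omega> in M. point_count \<Pi>\<^sub>0 A \<omega> = of_nat k) = measure \<mu> A ^ k / fact k * exp (- measure \<mu> A))) \<and>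
     (\<forall>A\<in>sets \<mu>. emeasure \<mu> A = \<infinity> \<longrightarrow> (AE \<omega> in M. point_count \<Pi>\<^sub>0 A \<omega> = \<infinity>)) \<and>
     (\<forall>n. \<forall>A :: nat \<Rightarrow> 'a set. (\<forall>i<n. A i \<in> sets \<mu>) \<longrightarrow> disjoint_family_on A {..<n} \<longrightarrow>
        prob_space.indep_vars M (\<lambda>_. borel) (\<lambda>i. point_count \<Pi>\<^sub>0 (A i)) {..<n})"

definition frechet_intensity :: "real measure" where
  "frechet_intensity = density (restrict_space lborel {0<..}) (\<lambda>t. ennreal (1 / t ^ 2))"


section \<open>Normalized spectral representations\<close>

text \<open>\<open>F t\<close>, for the points \<open>t\<close> of \<open>\<Pi>\<^sub>0\<close>, are independent copies of \<open>Fstar\<close>, independent of \<open>\<Pi>\<^sub>0\<close>.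
  Only the copies sitting at points of \<open>\<Pi>\<^sub>0\<close> are ever used. Independence of an
  uncountable family \<open>(F t)\<close>, \<open>t > 0\<close>, from \<open>\<Pi>\<^sub>0\<close> would say nothing about \<open>F\<close> evaluated at the
  random times in \<open>\<Pi>\<^sub>0\<close> (\<open>F\<close> need not be measurable in \<open>t\<close>), so the condition is imposed, as usual for
  marked Poisson processes, along a measurable enumeration \<open>T\<close> of \<open>\<Pi>\<^sub>0\<close>. Its last clause is
  \<open>indep_var\<close> for the sequence \<open>T\<close> and the sequence of copies, spelled out because the library's constant
  needs both variables to have the same type. Almost surely \<open>\<Pi>\<^sub>0\<close> is
  infinite, so the enumeration is indexed by all natural numbers. Copies are understood in the sense
  of \<^const>\<open>sup_law\<close>, i.e. together with their supremum over \<open>K\<close>.\<close>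

definition independent_copies_at_points ::
  "'w measure \<Rightarrow> ('w \<Rightarrow> real set) \<Rightarrow> (real \<Rightarrow> 'w \<Rightarrow> 'k \<Rightarrow> real) \<Rightarrow> 'k set
    \<Rightarrow> 'v measure \<Rightarrow> ('v \<Rightarrow> 'k \<Rightarrow> real) \<Rightarrow> bool" where
  "independent_copies_at_points R \<Pi>\<^sub>0 F K N Fstar \<longleftrightarrow>
     (\<exists>T :: nat \<Rightarrow> 'w \<Rightarrow> real.
        (\<forall>i. T i \<in> borel_measurable R) \<and>
        (AE \<omega> in R. bij_betw (\<lambda>i. T i \<omega>) UNIV (\<Pi>\<^sub>0 \<omega>)) \<and>
        (let G = (\<lambda>i \<omega> y. ereal (F (T i \<omega>) \<omega> y)) in
          (\<forall>i. sup_process R K (G i) \<and> sup_law R K (G i) = sup_law N K (\<lambda>\<omega> y. ereal (Fstar \<omega> y))) \<and>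
          prob_space.indep_vars R (\<lambda>_. path_space K) (\<lambda>i. sup_path K (G i)) UNIV \<and>
          prob_space.indep_set R
            (sets (vimage_algebra (space R) (\<lambda>\<omega> i. T i \<omega>) (PiM UNIV (\<lambda>_. borel))))
            (sets (vimage_algebra (space R) (\<lambda>\<omega> i. sup_path K (G i) \<omega>) (PiM UNIV (\<lambda>_. path_space K))))))"

definition spectral_max ::
  "('w \<Rightarrow> real set) \<Rightarrow> (real \<Rightarrow> 'w \<Rightarrow> 'k \<Rightarrow> real) \<Rightarrow> 'w \<Rightarrow> 'k \<Rightarrow> ereal" where
  "spectral_max \<Pi>\<^sub>0 F \<omega> y = (SUP t\<in>\<Pi>\<^sub>0 \<omega>. ereal (t * F t \<omega> y))"

text \<open>The process \<open>Z\<close> lives on \<open>M\<close>, the spectral process \<open>Fstar\<close> on \<open>N\<close>, and the Poisson process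
  with its copies of \<open>Fstar\<close> on \<open>R\<close>.\<close>

definition normalized_spectral_representation ::
  "'z measure \<Rightarrow> 'k set \<Rightarrow> ('z \<Rightarrow> 'k \<Rightarrow> real) \<Rightarrow> 'v measure \<Rightarrow> ('v \<Rightarrow> 'k \<Rightarrow> real)
    \<Rightarrow> 'w measure \<Rightarrow> ('w \<Rightarrow> real set) \<Rightarrow> (real \<Rightarrow> 'w \<Rightarrow> 'k \<Rightarrow> real) \<Rightarrow> real \<Rightarrow> bool" where
  "normalized_spectral_representation M K Z N Fstar R \<Pi>\<^sub>0 F c \<longleftrightarrow>
     c > 0 \<and>
     sup_process N K (\<lambda>\<omega> y. ereal (Fstar \<omega> y)) \<and>
     (\<forall>\<omega>\<in>space N. \<forall>y\<in>K. Fstar \<omega> y \<ge> 0) \<and>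
     (\<forall>\<omega>\<in>space N. path_sup K (\<lambda>\<omega> y. ereal (Fstar \<omega> y)) \<omega> = ereal c) \<and>
     poisson_point_process R frechet_intensity \<Pi>\<^sub>0 \<and>
     independent_copies_at_points R \<Pi>\<^sub>0 F K N Fstar \<and>
     sup_process R K (spectral_max \<Pi>\<^sub>0 F) \<and>
     sup_process M K (\<lambda>\<omega> y. ereal (Z \<omega> y)) \<and>
     sup_law M K (\<lambda>\<omega> y. ereal (Z \<omega> y)) = sup_law R K (spectral_max \<Pi>\<^sub>0 F)"

end

theory Submission
  imports Defs "HOL-Real_Asymp.Real_Asymp"
begin

text \<open>The path supremum of the spectral maximum is \<open>c\<close> times the largest point of \<open>\<Pi>\<^sub>0\<close>, so it exceeds
  \<open>z\<close> with probability \<open>1 - exp (- c / z)\<close>. Fix a small \<open>\<epsilon> > 0\<close>. Given that it exceeds \<open>z\<close>, with high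
  probability a single point \<open>t > z / c\<close> dominates, all others being at most \<open>\<epsilon> z / c\<close>; the
  exceptional event has two points above \<open>\<epsilon> z / c\<close> and hence probability of order \<open>1 / z\<^sup>2\<close>. When \<open>t\<close>
  dominates, the comparison of \<open>Z / Z\<^sup>K\<close> with \<open>w / c\<close> is the comparison of the copy \<open>F t\<close> with \<open>w\<close>, and
  this copy is independent of which point dominates.\<close>

section \<open>Events on the path space and their transfer between equal laws\<close>

lemma measurable_sup_path:
  assumes "sup_process M K X"
  shows "sup_path K X \<in> measurable M (path_space K)"
  using assms unfolding sup_process_def path_space_def sup_path_def [abs_def]
  by (intro measurable_Pair measurable_restrict) auto

lemma sup_path_vimage:
  assumes "sup_process M K X"
  shows "sup_path K X -` {p \<in> space (path_space K). \<phi> p} \<inter> space M = {\<omega> \<in> space M. \<phi> (sup_path K X \<omega>)}"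
  using measurable_space [OF measurable_sup_path [OF assms]] by auto

lemma sets_Collect_sup_path:
  assumes "sup_process M K X" and "{p \<in> space (path_space K). \<phi> p} \<in> sets (path_space K)"
  shows "{\<omega> \<in> space M. \<phi> (sup_path K X \<omega>)} \<in> sets M"
  using measurable_sets [OF measurable_sup_path [OF assms(1)] assms(2)]
  unfolding sup_path_vimage [OF assms(1)] .

lemma measure_sup_law:
  assumes "sup_process M K X" and "{p \<in> space (path_space K). \<phi> p} \<in> sets (path_space K)"
  shows "measure (sup_law M K X) {p \<in> space (path_space K). \<phi> p} = \<P>(\<omega> in M. \<phi> (sup_path K X \<omega>))"
  using measure_distr [OF measurable_sup_path [OF assms(1)] assms(2)]
  unfolding sup_law_def sup_path_vimage [OF assms(1)] .

text \<open>This is the form in which equality of \<open>sup_law\<close> is applied: any measurable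
  condition on the path together with its supremum has the same probability on both sides. It moves
  events from \<open>Z\<close> to the spectral maximum, and from a copy at a Poisson point to
  \<open>Fstar\<close>.\<close>

lemma prob_eq_if_sup_law_eq:
  assumes "sup_process M K X" "sup_process R K Y" "sup_law M K X = sup_law R K Y"
    and "{p \<in> space (path_space K). \<phi> p} \<in> sets (path_space K)"
  shows "\<P>(\<omega> in M. \<phi> (sup_path K X \<omega>)) = \<P>(\<omega> in R. \<phi> (sup_path K Y \<omega>))"
  using measure_sup_law [OF assms(1,4)] measure_sup_law [OF assms(2,4)] assms(3) by simp

section \<open>Numbers of Poisson points above a level\<close>

lemma sets_frechet_intensity: "b \<ge> 0 \<Longrightarrow> {b<..} \<in> sets frechet_intensity"
  unfolding frechet_intensity_def by (auto simp: sets_restrict_space_iff)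

lemma emeasure_frechet_intensity:
  assumes "b > 0"
  shows "emeasure frechet_intensity {b<..} = ennreal (1 / b)"
proof -
  have "emeasure frechet_intensity {b<..}
      = (\<integral>\<^sup>+ t. ennreal (1 / t ^ 2) * indicator {b<..} t \<partial>restrict_space lborel {0<..})"
    unfolding frechet_intensity_def using assms
    by (subst emeasure_density) (auto simp: sets_restrict_space_iff intro!: measurable_restrict_space1)
  also have "\<dots> = (\<integral>\<^sup>+ t. ennreal (1 / t ^ 2) * indicator {b<..} t * indicator {0<..} t \<partial>lborel)"
    by (subst nn_integral_restrict_space) auto
  \<comment> \<open>The endpoint \<open>b\<close>, a Lebesgue null set, is added because the
    fundamental theorem on a half-line is stated for a closed left end. The antiderivative is
    \<open>- 1 / t\<close>.\<close>
  also have "\<dots> = (\<integral>\<^sup>+ t. ennreal (1 / t ^ 2) * indicator {b..} t \<partial>lborel)"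
    using AE_lborel_singleton [of b] assms
    by (intro nn_integral_cong_AE) (auto elim!: eventually_mono simp: indicator_def)
  also have "\<dots> = ennreal (0 - (- 1 / b))"
  proof (rule nn_integral_FTC_atLeast)
    show "DERIV (\<lambda>t. - 1 / t) t :> 1 / t ^ 2" if "b \<le> t" for t
      using that assms by (auto intro!: derivative_eq_intros simp: power2_eq_square)
    show "((\<lambda>t. - 1 / t) \<longlongrightarrow> (0 :: real)) at_top" by real_asymp
    show "(\<lambda>t::real. 1 / t ^ 2) \<in> borel_measurable borel" by measurable
    show "0 \<le> 1 / t ^ 2" for t :: real by simp
  qed
  finally show ?thesis by simp
qed

text \<open>The number of points above \<open>b\<close> is Poisson with mean \<open>1 / b\<close>.
  The values 0 and 1 suffice: having at least two points is the complement of these two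
  events.\<close>

lemma poisson_frechet_counts:
  assumes pp: "poisson_point_process R frechet_intensity \<Pi>\<^sub>0" and b: "b > 0"
  shows "{\<omega> \<in> space R. \<Pi>\<^sub>0 \<omega> \<inter> {b<..} = {}} \<in> sets R" (is ?s0)
    and "\<P>(\<omega> in R. \<Pi>\<^sub>0 \<omega> \<inter> {b<..} = {}) = exp (- 1 / b)" (is ?p0)
    and "{\<omega> \<in> space R. \<exists>t. \<Pi>\<^sub>0 \<omega> \<inter> {b<..} = {t}} \<in> sets R" (is ?s1)
    and "\<P>(\<omega> in R. \<exists>t. \<Pi>\<^sub>0 \<omega> \<inter> {b<..} = {t}) = (1 / b) * exp (- 1 / b)" (is ?p1)
proof -
  have m: "point_count \<Pi>\<^sub>0 {b<..} \<in> borel_measurable R"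
    and p: "\<P>(\<omega> in R. point_count \<Pi>\<^sub>0 {b<..} \<omega> = of_nat k) = (1 / b) ^ k / fact k * exp (- (1 / b))" for k
    using pp b sets_frechet_intensity [of b] emeasure_frechet_intensity [OF b]
    unfolding poisson_point_process_def by (auto simp: measure_def)
  have e0: "point_count \<Pi>\<^sub>0 {b<..} \<omega> = of_nat 0 \<longleftrightarrow> \<Pi>\<^sub>0 \<omega> \<inter> {b<..} = {}" for \<omega>
    by (simp add: point_count_def emeasure_count_space_eq_0)
  \<comment> \<open>An infinite set has count \<infinity>, so a count equal to 1 forces finiteness,
    and then the count is the cardinality.\<close>
  have e1: "point_count \<Pi>\<^sub>0 {b<..} \<omega> = of_nat 1 \<longleftrightarrow> (\<exists>t. \<Pi>\<^sub>0 \<omega> \<inter> {b<..} = {t})" for \<omega>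
  proof (cases "finite (\<Pi>\<^sub>0 \<omega> \<inter> {b<..})")
    case True
    then have "point_count \<Pi>\<^sub>0 {b<..} \<omega> = of_nat (card (\<Pi>\<^sub>0 \<omega> \<inter> {b<..}))"
      by (simp add: point_count_def emeasure_count_space_finite)
    then show ?thesis by (metis of_nat_eq_iff card_1_singleton_iff One_nat_def)
  next
    case False
    then have "point_count \<Pi>\<^sub>0 {b<..} \<omega> \<noteq> of_nat 1"
      by (simp add: point_count_def emeasure_count_space_infinite)
    with False show ?thesis by (metis finite.emptyI finite.insertI)
  qed
  have ev: "{\<omega> \<in> space R. point_count \<Pi>\<^sub>0 {b<..} \<omega> = of_nat k} \<in> sets R" for k
  proof -
    have "point_count \<Pi>\<^sub>0 {b<..} -` {of_nat k} \<inter> space R = {\<omega> \<in> space R. point_count \<Pi>\<^sub>0 {b<..} \<omega> = of_nat k}"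
      by auto
    then show ?thesis using measurable_sets [OF m, of "{of_nat k}"] by simp
  qed
  show ?s0 using ev [of 0] unfolding e0 .
  show ?s1 using ev [of 1] unfolding e1 .
  show ?p0 using p [of 0] unfolding e0 by simp
  show ?p1 using p [of 1] unfolding e1 by simp
qed

text \<open>With mean \<lambda> = \<open>1 / b\<close>, the probability is 1 - (1 + \<lambda>)
  exp(-\<lambda>), and exp(-\<lambda>) \<ge> 1 - \<lambda> bounds it by \<lambda> squared. This is
  one order smaller than the probability of a single point as \<open>b\<close> grows.\<close>

lemma poisson_frechet_two_points_le:
  assumes pp: "poisson_point_process R frechet_intensity \<Pi>\<^sub>0" and b: "b > 0"
  shows "\<P>(\<omega> in R. \<Pi>\<^sub>0 \<omega> \<inter> {b<..} \<noteq> {} \<and> (\<nexists>t. \<Pi>\<^sub>0 \<omega> \<inter> {b<..} = {t})) \<le> (1 / b)\<^sup>2"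
proof -
  interpret prob_space R using pp by (simp add: poisson_point_process_def)
  note c = poisson_frechet_counts [OF pp b]
  have "\<P>(\<omega> in R. \<Pi>\<^sub>0 \<omega> \<inter> {b<..} \<noteq> {} \<and> (\<nexists>t. \<Pi>\<^sub>0 \<omega> \<inter> {b<..} = {t}))
      = prob (space R - ({\<omega> \<in> space R. \<Pi>\<^sub>0 \<omega> \<inter> {b<..} = {}} \<union> {\<omega> \<in> space R. \<exists>t. \<Pi>\<^sub>0 \<omega> \<inter> {b<..} = {t}}))"
    by (intro arg_cong [where f = prob]) auto
  also have "\<dots> = 1 - (exp (- 1 / b) + (1 / b) * exp (- 1 / b))"
    using c by (subst prob_compl, auto, subst finite_measure_Union) auto
  also have "\<dots> = 1 - (1 + 1 / b) * exp (- (1 / b))" by (simp add: algebra_simps)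
  also have "\<dots> \<le> 1 - (1 + 1 / b) * (1 - 1 / b)"
    using exp_ge_add_one_self [of "- (1 / b)"] b
    by (intro diff_left_mono mult_left_mono) auto
  also have "\<dots> = (1 / b)\<^sup>2" by (simp add: algebra_simps power2_eq_square)
  finally show ?thesis .
qed

section \<open>Independence at a randomly chosen index\<close>

text \<open>The disjoint events \<open>E k\<close> select at most one index, and \<open>B k\<close>
  is a condition on the mark there. Since all \<open>B k\<close> have the same probability, the
  factor \<open>q\<close> comes out of the sum over \<open>k\<close>; the selected mark behaves like
  a mark at a fixed index. No independence among the \<open>B k\<close> is involved.\<close>

lemma (in prob_space) prob_UN_indep_inter:
  assumes ind: "indep_set \<A> \<B>" and E: "\<And>k::nat. E k \<in> \<A>" and B: "\<And>k. B k \<in> \<B>"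
    and q: "\<And>k. prob (B k) = q" and disj: "disjoint_family E"
  shows "prob (\<Union>k. E k \<inter> B k) = q * prob (\<Union>k. E k)"
proof -
  have "\<A> \<subseteq> events" "\<B> \<subseteq> events"
    using ind by (auto simp: indep_set_def indep_sets_def split: bool.splits)
  then have E': "E k \<in> events" and B': "B k \<in> events" for k using E B by auto
  have "(\<lambda>k. prob (E k \<inter> B k)) sums prob (\<Union>k. E k \<inter> B k)"
    using E' B' disj by (intro finite_measure_UNION) (auto simp: disjoint_family_on_def, blast)
  moreover have "(\<lambda>k. q * prob (E k)) sums (q * prob (\<Union>k. E k))"
    using E' disj by (intro sums_mult finite_measure_UNION) auto
  moreover have "prob (E k \<inter> B k) = q * prob (E k)" for k
    using indep_setD [OF ind E B, of k k] q by simp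
  ultimately show ?thesis by (simp add: sums_unique2)
qed

section \<open>Pathwise analysis of the spectral maximum\<close>

text \<open>The suprema over \<open>K\<close> and over the points commute, and a positive
  \<open>t\<close> can be pulled out of the inner one, leaving \<open>t\<close> times the constant
  \<open>c\<close>. The supremum over \<open>K\<close> thus depends on the points alone.\<close>

lemma path_sup_spectral_max:
  assumes pos: "\<Pi>\<^sub>0 \<omega> \<subseteq> {0<..}" and K: "K \<noteq> {}"
    and sup: "\<And>t. t \<in> \<Pi>\<^sub>0 \<omega> \<Longrightarrow> (SUP y\<in>K. ereal (F t \<omega> y)) = ereal c"
  shows "path_sup K (spectral_max \<Pi>\<^sub>0 F) \<omega> = (SUP t\<in>\<Pi>\<^sub>0 \<omega>. ereal (c * t))"
proof -
  have "(SUP y\<in>K. ereal (t * F t \<omega> y)) = ereal (c * t)" if "t \<in> \<Pi>\<^sub>0 \<omega>" for t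
    using Sup_ereal_mult_left' [OF K, of t "\<lambda>y. ereal (F t \<omega> y)"] sup [OF that] pos that
    by (auto simp: mult.commute)
  then show ?thesis
    unfolding path_sup_def spectral_max_def by (subst SUP_commute) simp
qed

lemma path_sup_spectral_max_le_iff:
  assumes pos: "\<Pi>\<^sub>0 \<omega> \<subseteq> {0<..}" and K: "K \<noteq> {}" and c: "c > 0"
    and sup: "\<And>t. t \<in> \<Pi>\<^sub>0 \<omega> \<Longrightarrow> (SUP y\<in>K. ereal (F t \<omega> y)) = ereal c"
  shows "path_sup K (spectral_max \<Pi>\<^sub>0 F) \<omega> \<le> ereal z \<longleftrightarrow> \<Pi>\<^sub>0 \<omega> \<inter> {z / c<..} = {}"
proof -
  have "path_sup K (spectral_max \<Pi>\<^sub>0 F) \<omega> = (SUP t\<in>\<Pi>\<^sub>0 \<omega>. ereal (c * t))"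
    using assms by (intro path_sup_spectral_max) auto
  then show ?thesis
    using c by (auto simp: SUP_le_iff field_simps not_less disjoint_iff)
qed

text \<open>If every point of \<open>\<Pi>\<^sub>0\<close> other than \<open>t\<close> is at most \<open>\<epsilon> t\<close>, it contributes at most
  \<open>\<epsilon> t c \<le> t w\<close> to the maximum, so the comparison is decided by \<open>t\<close> alone.\<close>

lemma spectral_ratio_le_iff:
  assumes pos: "\<Pi>\<^sub>0 \<omega> \<subseteq> {0<..}" and c: "c > 0"
    and sup: "\<And>t. t \<in> \<Pi>\<^sub>0 \<omega> \<Longrightarrow> (SUP y\<in>K. ereal (F t \<omega> y)) = ereal c"
    and t: "t \<in> \<Pi>\<^sub>0 \<omega>" and others: "\<And>u. u \<in> \<Pi>\<^sub>0 \<omega> \<Longrightarrow> u \<noteq> t \<Longrightarrow> u \<le> \<epsilon> * t"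
    and \<epsilon>: "\<epsilon> \<le> 1" "\<epsilon> * c \<le> w" and y: "y \<in> K"
  shows "spectral_max \<Pi>\<^sub>0 F \<omega> y / path_sup K (spectral_max \<Pi>\<^sub>0 F) \<omega> \<le> ereal (w / c) \<longleftrightarrow> F t \<omega> y \<le> w"
proof -
  have t0: "t > 0" using pos t by auto
  \<comment> \<open>Because \<epsilon> \<le> 1, \<open>t\<close> is the largest point, so the
    supremum over \<open>K\<close> equals \<open>c * t\<close>.\<close>
  have "u \<le> t" if "u \<in> \<Pi>\<^sub>0 \<omega>" for u
  proof (cases "u = t")
    case False
    then have "u \<le> \<epsilon> * t" using others that by auto
    also have "\<dots> \<le> 1 * t" using \<epsilon> t0 by (intro mult_right_mono) auto
    finally show ?thesis by simp
  qed simp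
  then have "(SUP u\<in>\<Pi>\<^sub>0 \<omega>. ereal (c * u)) = ereal (c * t)"
    using c t by (intro antisym SUP_least SUP_upper2 [of t]) auto
  moreover have "path_sup K (spectral_max \<Pi>\<^sub>0 F) \<omega> = (SUP u\<in>\<Pi>\<^sub>0 \<omega>. ereal (c * u))"
    using y pos sup by (intro path_sup_spectral_max) auto
  ultimately have s: "path_sup K (spectral_max \<Pi>\<^sub>0 F) \<omega> = ereal (c * t)" by simp
  have Fu: "u * F u \<omega> y \<le> w * t" if u: "u \<in> \<Pi>\<^sub>0 \<omega>" "u \<noteq> t" for u
  proof -
    have "ereal (F u \<omega> y) \<le> ereal c" using sup [OF u(1)] y by (metis SUP_upper)
    then have "u * F u \<omega> y \<le> u * c" using u pos by (intro mult_left_mono) auto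
    also have "\<dots> \<le> \<epsilon> * t * c" using others [OF u] c by (intro mult_right_mono) auto
    also have "\<dots> = (\<epsilon> * c) * t" by simp
    also have "\<dots> \<le> w * t" using \<epsilon> t0 by (intro mult_right_mono) auto
    finally show ?thesis .
  qed
  \<comment> \<open>Multiplying by the positive finite number \<open>c * t\<close> turns the
    threshold \<open>w / c\<close> into \<open>w * t\<close>.\<close>
  have "spectral_max \<Pi>\<^sub>0 F \<omega> y / path_sup K (spectral_max \<Pi>\<^sub>0 F) \<omega> \<le> ereal (w / c)
      \<longleftrightarrow> spectral_max \<Pi>\<^sub>0 F \<omega> y \<le> ereal (w * t)"
    unfolding s using c t0 by (subst ereal_divide_le_pos) (auto simp: field_simps)
  also have "\<dots> \<longleftrightarrow> (\<forall>u\<in>\<Pi>\<^sub>0 \<omega>. u * F u \<omega> y \<le> w * t)"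
    unfolding spectral_max_def by (simp add: SUP_le_iff)
  also have "\<dots> \<longleftrightarrow> t * F t \<omega> y \<le> w * t" using Fu t by auto
  also have "\<dots> \<longleftrightarrow> F t \<omega> y \<le> w" using t0 by (simp add: mult.commute)
  finally show ?thesis .
qed

section \<open>Measurable events of the path space\<close>

lemma sets_path_space_snd:
  shows "{p \<in> space (path_space K). snd p \<le> ereal z} \<in> sets (path_space K)"
    and "{p \<in> space (path_space K). snd p = ereal z} \<in> sets (path_space K)"
    and "{p \<in> space (path_space K). snd p > ereal z} \<in> sets (path_space K)"
proof -
  have [measurable]: "snd \<in> borel_measurable (path_space K)" by (simp add: path_space_def)
  show "{p \<in> space (path_space K). snd p \<le> ereal z} \<in> sets (path_space K)"
    "{p \<in> space (path_space K). snd p = ereal z} \<in> sets (path_space K)"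
    "{p \<in> space (path_space K). snd p > ereal z} \<in> sets (path_space K)"
    by measurable
qed

lemma sets_path_space_fst:
  assumes "\<And>i. i \<in> I \<Longrightarrow> y i \<in> K" and "finite I"
  shows "{p \<in> space (path_space K). \<forall>i\<in>I. fst p (y i) \<le> ereal (w i)} \<in> sets (path_space K)"
    and "{p \<in> space (path_space K). (\<forall>i\<in>I. fst p (y i) / snd p \<le> ereal (w i)) \<and> snd p > ereal z}
      \<in> sets (path_space K)"
proof -
  have s: "snd \<in> borel_measurable (path_space K)" by (simp add: path_space_def)
  have f: "(\<lambda>p. fst p (y i)) \<in> borel_measurable (path_space K)" if "i \<in> I" for i
    unfolding path_space_def using assms(1) [OF that]
    by (intro measurable_compose [OF measurable_fst] measurable_component_singleton)
  show "{p \<in> space (path_space K). \<forall>i\<in>I. fst p (y i) \<le> ereal (w i)} \<in> sets (path_space K)"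
    using f assms(2) by (intro sets.sets_Collect_finite_All borel_measurable_le) auto
  show "{p \<in> space (path_space K). (\<forall>i\<in>I. fst p (y i) / snd p \<le> ereal (w i)) \<and> snd p > ereal z}
      \<in> sets (path_space K)"
    using f s assms(2)
    by (intro sets.sets_Collect_conj sets.sets_Collect_finite_All borel_measurable_le
        borel_measurable_less borel_measurable_ereal_divide) auto
qed

lemma fst_sup_path [simp]: "y \<in> K \<Longrightarrow> fst (sup_path K X \<omega>) y = X \<omega> y"
  and snd_sup_path [simp]: "snd (sup_path K X \<omega>) = path_sup K X \<omega>"
  by (simp_all add: sup_path_def)

section \<open>Almost sure normalization and the law of the supremum\<close>

text \<open>In \<open>ereal\<close> the supremum over the empty set is -\<infinity>, whereas the
  paths of \<open>Fstar\<close> have the finite supremum \<open>c\<close>.\<close>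

lemma normalized_spectral_representation_nonempty:
  assumes "normalized_spectral_representation M K Z N Fstar R \<Pi>\<^sub>0 F c"
  shows "K \<noteq> {}"
proof -
  interpret N: prob_space N
    using assms by (simp add: normalized_spectral_representation_def sup_process_def)
  obtain \<omega> where "\<omega> \<in> space N" using N.not_empty by auto
  then have "(SUP y\<in>K. ereal (Fstar \<omega> y)) = ereal c"
    using assms by (auto simp: normalized_spectral_representation_def path_sup_def)
  then show ?thesis by (auto simp: bot_ereal_def)
qed

text \<open>The supremum is a coordinate of \<open>sup_law\<close>, so each copy along the
  enumeration \<open>T\<close> inherits the value \<open>c\<close> almost surely. There are
  countably many copies, so one null set serves all points of \<open>\<Pi>\<^sub>0\<close> at
  once.\<close>

lemma AE_path_sup_copies:
  fixes R :: "'w measure"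
  assumes rep: "normalized_spectral_representation M K Z N Fstar R \<Pi>\<^sub>0 F c"
  shows "AE \<omega> in R. \<Pi>\<^sub>0 \<omega> \<subseteq> {0<..} \<and> (\<forall>t\<in>\<Pi>\<^sub>0 \<omega>. (SUP y\<in>K. ereal (F t \<omega> y)) = ereal c)"
proof -
  have pp: "poisson_point_process R frechet_intensity \<Pi>\<^sub>0"
    and N: "sup_process N K (\<lambda>\<omega> y. ereal (Fstar \<omega> y))"
    and Fc: "\<And>\<omega>. \<omega> \<in> space N \<Longrightarrow> path_sup K (\<lambda>\<omega> y. ereal (Fstar \<omega> y)) \<omega> = ereal c"
    using rep by (auto simp: normalized_spectral_representation_def)
  interpret R: prob_space R using pp by (simp add: poisson_point_process_def)
  interpret N: prob_space N using N by (simp add: sup_process_def)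
  obtain T :: "nat \<Rightarrow> 'w \<Rightarrow> real" where
    T: "AE \<omega> in R. bij_betw (\<lambda>i. T i \<omega>) UNIV (\<Pi>\<^sub>0 \<omega>)"
    and G: "\<And>i. sup_process R K (\<lambda>\<omega> y. ereal (F (T i \<omega>) \<omega> y))"
    and law: "\<And>i. sup_law R K (\<lambda>\<omega> y. ereal (F (T i \<omega>) \<omega> y)) = sup_law N K (\<lambda>\<omega> y. ereal (Fstar \<omega> y))"
    using rep unfolding normalized_spectral_representation_def independent_copies_at_points_def Let_def
    by blast
  have "AE \<omega> in R. path_sup K (\<lambda>\<omega> y. ereal (F (T i \<omega>) \<omega> y)) \<omega> = ereal c" for i
  proof -
    have "\<P>(\<omega> in R. snd (sup_path K (\<lambda>\<omega> y. ereal (F (T i \<omega>) \<omega> y)) \<omega>) = ereal c)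
        = \<P>(\<omega> in N. snd (sup_path K (\<lambda>\<omega> y. ereal (Fstar \<omega> y)) \<omega>) = ereal c)"
      by (rule prob_eq_if_sup_law_eq [OF G N law]) (rule sets_path_space_snd(2))
    also have "\<dots> = 1" using Fc N.prob_space by (simp cong: conj_cong)
    finally show ?thesis
      using G [of i] by (subst R.prob_Collect_eq_1 [symmetric]) (auto simp: sup_process_def)
  qed
  then have "AE \<omega> in R. \<forall>i. path_sup K (\<lambda>\<omega> y. ereal (F (T i \<omega>) \<omega> y)) \<omega> = ereal c"
    by (simp add: AE_all_countable)
  moreover have "AE \<omega> in R. \<Pi>\<^sub>0 \<omega> \<subseteq> {0<..}"
    using pp by (auto simp: poisson_point_process_def frechet_intensity_def space_restrict_space)
  ultimately show ?thesis
    using T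
  proof eventually_elim
    case (elim \<omega>)
    have "(SUP y\<in>K. ereal (F t \<omega> y)) = ereal c" if "t \<in> \<Pi>\<^sub>0 \<omega>" for t
    proof -
      have "t \<in> range (\<lambda>i. T i \<omega>)" using that elim(3) by (simp add: bij_betw_def)
      then obtain i where "t = T i \<omega>" by (rule rangeE)
      then show ?thesis using elim(1) by (simp add: path_sup_def)
    qed
    with elim(2) show ?case by simp
  qed
qed

text \<open>Up to a null set, the supremum is at most \<open>z\<close> exactly when
  \<open>\<Pi>\<^sub>0\<close> has no point above \<open>z / c\<close>; this void probability is the
  exponential.\<close>

lemma prob_path_sup_le:
  assumes rep: "normalized_spectral_representation M K Z N Fstar R \<Pi>\<^sub>0 F c" and z: "z > 0"
  shows "\<P>(\<omega> in R. path_sup K (spectral_max \<Pi>\<^sub>0 F) \<omega> \<le> ereal z) = exp (- c / z)"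
proof -
  have pp: "poisson_point_process R frechet_intensity \<Pi>\<^sub>0" and c: "c > 0"
    and V: "path_sup K (spectral_max \<Pi>\<^sub>0 F) \<in> borel_measurable R"
    using rep by (auto simp: normalized_spectral_representation_def sup_process_def)
  interpret prob_space R using pp by (simp add: poisson_point_process_def)
  have "\<P>(\<omega> in R. path_sup K (spectral_max \<Pi>\<^sub>0 F) \<omega> \<le> ereal z) = \<P>(\<omega> in R. \<Pi>\<^sub>0 \<omega> \<inter> {z / c<..} = {})"
  proof (rule prob_eq_AE)
    show "AE \<omega> in R. path_sup K (spectral_max \<Pi>\<^sub>0 F) \<omega> \<le> ereal z \<longleftrightarrow> \<Pi>\<^sub>0 \<omega> \<inter> {z / c<..} = {}"
      using AE_path_sup_copies [OF rep]
    proof eventually_elim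
      case (elim \<omega>)
      then show ?case
        using normalized_spectral_representation_nonempty [OF rep] c
        by (intro path_sup_spectral_max_le_iff) auto
    qed
    show "{\<omega> \<in> space R. path_sup K (spectral_max \<Pi>\<^sub>0 F) \<omega> \<le> ereal z} \<in> events"
      using V by simp
    show "{\<omega> \<in> space R. \<Pi>\<^sub>0 \<omega> \<inter> {z / c<..} = {}} \<in> events"
      using z c by (intro poisson_frechet_counts [OF pp]) simp
  qed
  also have "\<dots> = exp (- c / z)"
    using poisson_frechet_counts [OF pp, of "z / c"] z c by simp
  finally show ?thesis .
qed

section \<open>The tail estimate\<close>

text \<open>The joint tail event factorizes exactly when a single point dominates; the error is at
  most the probability of two points above \<open>\<epsilon> * z / c\<close>.\<close>

lemma spectral_tail_error:
  fixes R :: "'w measure"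
  assumes rep: "normalized_spectral_representation M K Z N Fstar R \<Pi>\<^sub>0 F c"
    and y: "\<And>i. i \<in> {1..n::nat} \<Longrightarrow> y i \<in> K"
    and \<epsilon>: "0 < \<epsilon>" "\<epsilon> \<le> 1" "\<And>i. i \<in> {1..n} \<Longrightarrow> \<epsilon> * c \<le> w i" and z: "z > 0"
  shows "\<bar>\<P>(\<omega> in R. (\<forall>i\<in>{1..n}. spectral_max \<Pi>\<^sub>0 F \<omega> (y i) / path_sup K (spectral_max \<Pi>\<^sub>0 F) \<omega> \<le> ereal (w i / c))
            \<and> path_sup K (spectral_max \<Pi>\<^sub>0 F) \<omega> > ereal z)
        - \<P>(\<omega> in N. \<forall>i\<in>{1..n}. Fstar \<omega> (y i) \<le> w i) * \<P>(\<omega> in R. path_sup K (spectral_max \<Pi>\<^sub>0 F) \<omega> > ereal z)\<bar>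
      \<le> (c / (\<epsilon> * z))\<^sup>2"
proof -
  define S where "S = path_sup K (spectral_max \<Pi>\<^sub>0 F)"
  define q where "q = \<P>(\<omega> in N. \<forall>i\<in>{1..n}. Fstar \<omega> (y i) \<le> w i)"
  have pp: "poisson_point_process R frechet_intensity \<Pi>\<^sub>0" and c: "c > 0"
    and N: "sup_process N K (\<lambda>\<omega> y. ereal (Fstar \<omega> y))"
    and V: "sup_process R K (spectral_max \<Pi>\<^sub>0 F)"
    using rep by (auto simp: normalized_spectral_representation_def)
  interpret prob_space R using pp by (simp add: poisson_point_process_def)
  interpret N: prob_space N using N by (simp add: sup_process_def)
  obtain T :: "nat \<Rightarrow> 'w \<Rightarrow> real" where
    T: "AE \<omega> in R. bij_betw (\<lambda>i. T i \<omega>) UNIV (\<Pi>\<^sub>0 \<omega>)"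
    and G: "\<And>i. sup_process R K (\<lambda>\<omega> y. ereal (F (T i \<omega>) \<omega> y))"
    and law: "\<And>i. sup_law R K (\<lambda>\<omega> y. ereal (F (T i \<omega>) \<omega> y)) = sup_law N K (\<lambda>\<omega> y. ereal (Fstar \<omega> y))"
    and ind: "indep_set
            (sets (vimage_algebra (space R) (\<lambda>\<omega> i. T i \<omega>) (PiM UNIV (\<lambda>_. borel))))
            (sets (vimage_algebra (space R) (\<lambda>\<omega> i. sup_path K (\<lambda>\<omega> y. ereal (F (T i \<omega>) \<omega> y)) \<omega>)
              (PiM UNIV (\<lambda>_. path_space K))))"
    using rep unfolding normalized_spectral_representation_def independent_copies_at_points_def Let_def
    by blast
  \<comment> \<open>The supremum exceeds \<open>z\<close> exactly when some point exceeds
    \<open>a\<close>, up to a null set.\<close>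
  define a where "a = z / c"
  have a: "a > 0" "\<epsilon> * a > 0" "\<epsilon> * a \<le> a"
    using z c \<epsilon> by (auto simp: a_def intro!: divide_right_mono mult_left_le_one_le)
  \<comment> \<open>\<open>E k\<close> (the \<open>k\<close>-th point dominates) involves only the
    points, and \<open>B k\<close> only the \<open>k\<close>-th copy; this lets the independence of
    \<open>T\<close> from the copies apply. \<open>D\<close> is the exceptional event of at least
    two points above \<open>\<epsilon> * a\<close>.\<close>
  define E where "E k = {\<omega> \<in> space R. a < T k \<omega> \<and> (\<forall>j. j \<noteq> k \<longrightarrow> T j \<omega> \<le> \<epsilon> * a)}" for k
  define B where "B k = {\<omega> \<in> space R. \<forall>i\<in>{1..n}. F (T k \<omega>) \<omega> (y i) \<le> w i}" for k
  define D where "D = {\<omega> \<in> space R. \<Pi>\<^sub>0 \<omega> \<inter> {\<epsilon> * a<..} \<noteq> {} \<and> (\<nexists>t. \<Pi>\<^sub>0 \<omega> \<inter> {\<epsilon> * a<..} = {t})}"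
  define A where "A = {\<omega> \<in> space R. (\<forall>i\<in>{1..n}. spectral_max \<Pi>\<^sub>0 F \<omega> (y i) / S \<omega> \<le> ereal (w i / c)) \<and> S \<omega> > ereal z}"
  define H where "H = {\<omega> \<in> space R. S \<omega> > ereal z}"
  have Em: "E k \<in> sets (vimage_algebra (space R) (\<lambda>\<omega> i. T i \<omega>) (PiM UNIV (\<lambda>_. borel)))" for k
  proof -
    have "{x \<in> space (PiM UNIV (\<lambda>_. borel)). a < x k \<and> (\<forall>j. j \<noteq> k \<longrightarrow> x j \<le> \<epsilon> * a)}
        \<in> sets (PiM (UNIV :: nat set) (\<lambda>_. borel :: real measure))"
      by measurable
    from in_vimage_algebra [OF this, of "\<lambda>\<omega> i. T i \<omega>" "space R"] show ?thesis
      by (rule back_subst [of "\<lambda>X. X \<in> _"]) (auto simp: E_def space_PiM)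
  qed
  have Bm: "B k \<in> sets (vimage_algebra (space R) (\<lambda>\<omega> i. sup_path K (\<lambda>\<omega> y. ereal (F (T i \<omega>) \<omega> y)) \<omega>)
              (PiM UNIV (\<lambda>_. path_space K)))" for k
  proof -
    have ev: "{p \<in> space (path_space K). \<forall>i\<in>{1..n}. fst p (y i) \<le> ereal (w i)} \<in> sets (path_space K)"
      using y by (intro sets_path_space_fst) auto
    have "(\<lambda>p. p k) \<in> measurable (PiM (UNIV :: nat set) (\<lambda>_. path_space K)) (path_space K)"
      by (intro measurable_component_singleton) simp
    note in_vimage_algebra [OF measurable_sets [OF this ev],
        of "\<lambda>\<omega> i. sup_path K (\<lambda>\<omega> y. ereal (F (T i \<omega>) \<omega> y)) \<omega>" "space R"]
    moreover have "(\<lambda>\<omega> i. sup_path K (\<lambda>\<omega> y. ereal (F (T i \<omega>) \<omega> y)) \<omega>) -`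
          ((\<lambda>p. p k) -` {p \<in> space (path_space K). \<forall>i\<in>{1..n}. fst p (y i) \<le> ereal (w i)}
            \<inter> space (PiM UNIV (\<lambda>_. path_space K))) \<inter> space R = B k"
      using measurable_space [OF measurable_sup_path [OF G]] y
      by (auto simp: B_def space_PiM)
    ultimately show ?thesis by simp
  qed
  have q: "prob (B k) = q" for k
  proof -
    have "\<P>(\<omega> in R. \<forall>i\<in>{1..n}. fst (sup_path K (\<lambda>\<omega> y. ereal (F (T k \<omega>) \<omega> y)) \<omega>) (y i) \<le> ereal (w i))
        = \<P>(\<omega> in N. \<forall>i\<in>{1..n}. fst (sup_path K (\<lambda>\<omega> y. ereal (Fstar \<omega> y)) \<omega>) (y i) \<le> ereal (w i))"
      by (rule prob_eq_if_sup_law_eq [OF G N law]) (rule sets_path_space_fst(1) [OF y], auto)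
    then show ?thesis using y by (simp add: B_def q_def)
  qed
  \<comment> \<open>Two indices cannot both dominate: one value would be above \<open>a\<close> and
    also at most \<open>\<epsilon> * a \<le> a\<close>.\<close>
  have disj: "disjoint_family E"
    using a by (force simp: disjoint_family_on_def E_def)
  have main: "prob (\<Union>k. E k \<inter> B k) = q * prob (\<Union>k. E k)"
    using prob_UN_indep_inter [OF ind Em Bm q disj] .
  have Ev: "E k \<in> events" "B k \<in> events" for k
    using ind Em [of k] Bm [of k] by (auto simp: indep_set_def indep_sets_def split: bool.splits)
  have Dev: "D \<in> events"
    using poisson_frechet_counts(1,3) [OF pp a(2)] unfolding D_def
    by (intro sets.sets_Collect_conj sets.sets_Collect_neg)
  have Hev: "H \<in> events"
    using sets_Collect_sup_path [OF V sets_path_space_snd(3) [of K z]] by (simp add: H_def S_def)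
  have Aev: "A \<in> events"
  proof -
    have "{p \<in> space (path_space K). (\<forall>i\<in>{1..n}. fst p (y i) / snd p \<le> ereal (w i / c)) \<and> snd p > ereal z}
        \<in> sets (path_space K)"
      using y by (intro sets_path_space_fst) auto
    from sets_Collect_sup_path [OF V this] show ?thesis
      using y by (simp add: A_def S_def cong: conj_cong)
  qed
  have D: "prob D \<le> (c / (\<epsilon> * z))\<^sup>2"
    using poisson_frechet_two_points_le [OF pp a(2)] c by (simp add: D_def a_def)
  \<comment> \<open>Two almost sure sandwiches: \<open>A\<close> lies between the union of the
    \<open>E k \<inter> B k\<close> and that union enlarged by \<open>D\<close>, and likewise
    \<open>H\<close> for the union of the \<open>E k\<close>.\<close>
  have ae: "AE \<omega> in R. (\<omega> \<in> (\<Union>k. E k \<inter> B k) \<longrightarrow> \<omega> \<in> A) \<and> (\<omega> \<in> A \<longrightarrow> \<omega> \<in> (\<Union>k. E k \<inter> B k) \<union> D)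
      \<and> (\<omega> \<in> (\<Union>k. E k) \<longrightarrow> \<omega> \<in> H) \<and> (\<omega> \<in> H \<longrightarrow> \<omega> \<in> (\<Union>k. E k) \<union> D)"
    using AE_path_sup_copies [OF rep] T AE_space
  proof eventually_elim
    case (elim \<omega>)
    then have pos: "\<Pi>\<^sub>0 \<omega> \<subseteq> {0<..}" and sup: "\<And>t. t \<in> \<Pi>\<^sub>0 \<omega> \<Longrightarrow> (SUP y\<in>K. ereal (F t \<omega> y)) = ereal c"
      by auto
    have inj: "T i \<omega> = T j \<omega> \<longleftrightarrow> i = j" for i j using elim(2) by (auto simp: bij_betw_def inj_on_def)
    have ran: "\<Pi>\<^sub>0 \<omega> = range (\<lambda>i. T i \<omega>)" using elim(2) by (simp add: bij_betw_def)
    have "S \<omega> \<le> ereal z \<longleftrightarrow> \<Pi>\<^sub>0 \<omega> \<inter> {a<..} = {}"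
      unfolding S_def a_def using pos sup c normalized_spectral_representation_nonempty [OF rep]
      by (intro path_sup_spectral_max_le_iff) auto
    moreover have "\<Pi>\<^sub>0 \<omega> \<inter> {a<..} = {} \<longleftrightarrow> (\<forall>k. \<not> T k \<omega> > a)"
      unfolding ran by blast
    ultimately have S: "S \<omega> > ereal z \<longleftrightarrow> (\<exists>k. T k \<omega> > a)"
      by (metis not_le)
    \<comment> \<open>A point above \<open>a\<close> is also above \<open>\<epsilon> * a\<close>;
      off \<open>D\<close> it is the only such point, so every other point is at most
      \<open>\<epsilon> * a\<close>.\<close>
    have HE: "\<omega> \<in> (\<Union>k. E k)" if H: "\<omega> \<in> H" and nD: "\<omega> \<notin> D"
    proof -
      have "S \<omega> > ereal z" using H by (simp add: H_def)
      then obtain k where k: "T k \<omega> > a" using S by blast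
      have mem: "T k \<omega> \<in> \<Pi>\<^sub>0 \<omega> \<inter> {\<epsilon> * a<..}"
        using k a unfolding ran by auto
      then obtain t where t: "\<Pi>\<^sub>0 \<omega> \<inter> {\<epsilon> * a<..} = {t}"
        using nD elim(3) unfolding D_def by blast
      have "T j \<omega> \<le> \<epsilon> * a" if "j \<noteq> k" for j
      proof (rule ccontr)
        assume "\<not> T j \<omega> \<le> \<epsilon> * a"
        then have "T j \<omega> \<in> \<Pi>\<^sub>0 \<omega> \<inter> {\<epsilon> * a<..}" unfolding ran by auto
        with mem have "T j \<omega> = T k \<omega>" unfolding t by simp
        then show False using inj that by blast
      qed
      then show ?thesis using k elim(3) unfolding E_def by blast
    qed
    have EA: "\<omega> \<in> A \<longleftrightarrow> \<omega> \<in> B k" if k: "\<omega> \<in> E k" for k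
    proof -
      have "spectral_max \<Pi>\<^sub>0 F \<omega> (y i) / S \<omega> \<le> ereal (w i / c) \<longleftrightarrow> F (T k \<omega>) \<omega> (y i) \<le> w i"
        if i: "i \<in> {1..n}" for i
        unfolding S_def
      proof (rule spectral_ratio_le_iff [where \<epsilon> = \<epsilon>])
        show "u \<le> \<epsilon> * T k \<omega>" if u: "u \<in> \<Pi>\<^sub>0 \<omega>" "u \<noteq> T k \<omega>" for u
        proof -
          obtain j where j: "u = T j \<omega>" using u unfolding ran by blast
          then have "u \<le> \<epsilon> * a" using k u by (auto simp: E_def)
          \<comment> \<open>\<open>E k\<close> bounds the other points by
            \<open>\<epsilon> * a\<close>; since \<open>a < T k \<omega>\<close>, they are small
            relative to the dominating point itself.\<close>
          also have "\<dots> \<le> \<epsilon> * T k \<omega>" using k \<epsilon> by (intro mult_left_mono) (auto simp: E_def)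
          finally show ?thesis .
        qed
        show "T k \<omega> \<in> \<Pi>\<^sub>0 \<omega>" unfolding ran by blast
        show "\<epsilon> \<le> 1" "\<epsilon> * c \<le> w i" "y i \<in> K" using \<epsilon> y i by blast+
      qed (fact pos c sup)+
      then show ?thesis using k S elim(3) by (auto simp: A_def B_def E_def)
    qed
    have EH: "\<omega> \<in> H" if "\<omega> \<in> E k" for k
      using that S unfolding E_def H_def by blast
    have AH: "\<omega> \<in> A \<Longrightarrow> \<omega> \<in> H" by (simp add: A_def H_def)
    show ?case using HE EA EH AH by blast
  qed
  have UE: "(\<Union>k. E k) \<in> events" and UB: "(\<Union>k. E k \<inter> B k) \<in> events" using Ev by auto
  have q01: "0 \<le> q" "q \<le> 1" by (auto simp: q_def)
  \<comment> \<open>By \<open>main\<close>, both \<open>prob A\<close> and \<open>q * prob H\<close>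
    lie in the interval of length \<open>prob D\<close> starting at
    \<open>q * prob (\<Union>k. E k)\<close>. Hence they differ by at most \<open>prob D\<close>,
    with no factor 2.\<close>
  have "prob (\<Union>k. E k \<inter> B k) \<le> prob A"
    using ae by (intro finite_measure_mono_AE Aev) (auto elim!: eventually_mono)
  moreover have "prob A \<le> prob (\<Union>k. E k \<inter> B k) + prob D"
  proof -
    have "prob A \<le> prob ((\<Union>k. E k \<inter> B k) \<union> D)"
      using ae UB Dev by (intro finite_measure_mono_AE) (auto elim!: eventually_mono)
    also have "\<dots> \<le> prob (\<Union>k. E k \<inter> B k) + prob D"
      by (rule measure_Un_le [OF UB Dev])
    finally show ?thesis .
  qed
  moreover have "q * prob (\<Union>k. E k) \<le> q * prob H"
    using ae q01 by (intro mult_left_mono finite_measure_mono_AE Hev) (auto elim!: eventually_mono)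
  moreover have "q * prob H \<le> q * prob (\<Union>k. E k) + prob D"
  proof -
    have "prob H \<le> prob ((\<Union>k. E k) \<union> D)"
      using ae UE Dev by (intro finite_measure_mono_AE) (auto elim!: eventually_mono)
    also have "\<dots> \<le> prob (\<Union>k. E k) + prob D"
      by (rule measure_Un_le [OF UE Dev])
    finally have "q * prob H \<le> q * prob (\<Union>k. E k) + q * prob D"
      using q01 by (metis distrib_left mult_left_mono)
    also have "q * prob D \<le> 1 * prob D" using q01 by (intro mult_right_mono) auto
    finally show ?thesis by simp
  qed
  ultimately have "\<bar>prob A - q * prob H\<bar> \<le> (c / (\<epsilon> * z))\<^sup>2" using main D by linarith
  then show ?thesis unfolding A_def H_def q_def S_def .
qed

section \<open>The constant \<open>c\<close> and the conditional limit\<close>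

theorem proposition2p5:
  fixes K :: "'k::polish_space set"
    and M :: "'z measure" and Z :: "'z \<Rightarrow> 'k \<Rightarrow> real"
    and N :: "'v measure" and Fstar :: "'v \<Rightarrow> 'k \<Rightarrow> real"
    and R :: "'w measure" and \<Pi>\<^sub>0 :: "'w \<Rightarrow> real set" and F :: "real \<Rightarrow> 'w \<Rightarrow> 'k \<Rightarrow> real"
    and c :: real and ZK :: "'z \<Rightarrow> ereal"
  assumes "compact K"
    and "max_stable_process M K Z"
    and "normalized_spectral_representation M K Z N Fstar R \<Pi>\<^sub>0 F c"
    and "ZK = path_sup K (\<lambda>\<omega> y. ereal (Z \<omega> y))"
  shows "c = - ln \<P>(\<omega> in M. ZK \<omega> \<le> 1) \<and>
    (\<forall>(n::nat) (y :: nat \<Rightarrow> 'k) (w :: nat \<Rightarrow> real).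
       (\<forall>i\<in>{1..n}. y i \<in> K \<and> w i > 0) \<longrightarrow>
       ((\<lambda>z::real. \<P>(\<omega> in M. (\<forall>i\<in>{1..n}. ereal (Z \<omega> (y i)) / ZK \<omega> \<le> ereal (w i / c)) \<bar> ZK \<omega> > ereal z))
          \<longlongrightarrow> \<P>(\<omega> in N. \<forall>i\<in>{1..n}. Fstar \<omega> (y i) \<le> w i)) at_top)"
proof (intro conjI allI impI)
  note rep = assms(3)
  let ?V = "spectral_max \<Pi>\<^sub>0 F" and ?S = "path_sup K (spectral_max \<Pi>\<^sub>0 F)"
  have c: "c > 0" and V: "sup_process R K ?V"
    and Zp: "sup_process M K (\<lambda>\<omega> y. ereal (Z \<omega> y))"
    and law: "sup_law M K (\<lambda>\<omega> y. ereal (Z \<omega> y)) = sup_law R K ?V"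
    using rep by (auto simp: normalized_spectral_representation_def)
  interpret R: prob_space R using V by (simp add: sup_process_def)
  note transfer = prob_eq_if_sup_law_eq [OF Zp V law]
  show "c = - ln \<P>(\<omega> in M. ZK \<omega> \<le> 1)"
    using transfer [OF sets_path_space_snd(1) [of K 1]] prob_path_sup_le [OF rep, of 1]
    by (simp add: assms(4) one_ereal_def)
  fix n :: nat and y :: "nat \<Rightarrow> 'k" and w :: "nat \<Rightarrow> real"
  assume yw: "\<forall>i\<in>{1..n}. y i \<in> K \<and> w i > 0"
  then have y: "\<And>i. i \<in> {1..n} \<Longrightarrow> y i \<in> K" by auto
  let ?q = "\<P>(\<omega> in N. \<forall>i\<in>{1..n}. Fstar \<omega> (y i) \<le> w i)"
  let ?f = "\<lambda>z. \<P>(\<omega> in M. (\<forall>i\<in>{1..n}. ereal (Z \<omega> (y i)) / ZK \<omega> \<le> ereal (w i / c)) \<bar> ZK \<omega> > ereal z)"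
  \<comment> \<open>The values \<open>w i / c\<close> ensure
    \<open>\<epsilon> * c \<le> w i\<close>. Inserting 1 ensures \<epsilon> \<le> 1 and keeps the
    set nonempty when \<open>n = 0\<close>.\<close>
  define \<epsilon> where "\<epsilon> = Min (insert 1 ((\<lambda>i. w i / c) ` {1..n}))"
  have \<epsilon>: "0 < \<epsilon>" "\<epsilon> \<le> 1" using yw c by (auto simp: \<epsilon>_def)
  have \<epsilon>w: "\<epsilon> * c \<le> w i" if "i \<in> {1..n}" for i
  proof -
    have "\<epsilon> \<le> w i / c" unfolding \<epsilon>_def using that by (intro Min_le) auto
    then show ?thesis using c by (simp add: field_simps)
  qed
  \<comment> \<open>The tail error is divided by the probability of the conditioning event, which is
    positive for every \<open>z > 0\<close>.\<close>
  have bound: "\<bar>?f z - ?q\<bar> \<le> (c / (\<epsilon> * z))\<^sup>2 / (1 - exp (- c / z))" if z: "z > 0" for z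
  proof -
    let ?A = "\<P>(\<omega> in R. (\<forall>i\<in>{1..n}. ?V \<omega> (y i) / ?S \<omega> \<le> ereal (w i / c)) \<and> ?S \<omega> > ereal z)"
    let ?H = "\<P>(\<omega> in R. ?S \<omega> > ereal z)"
    have ev: "{p \<in> space (path_space K). (\<forall>i\<in>{1..n}. fst p (y i) / snd p \<le> ereal (w i / c)) \<and> snd p > ereal z}
        \<in> sets (path_space K)"
      using y by (intro sets_path_space_fst) auto
    have f: "?f z = ?A / ?H"
      using transfer [OF ev]
        transfer [OF sets_path_space_snd(3) [of K z]] y
      by (simp add: cond_prob_def assms(4) cong: conj_cong)
    have "?H = 1 - \<P>(\<omega> in R. ?S \<omega> \<le> ereal z)"
      using V by (subst R.prob_neg [symmetric]) (auto simp: not_le sup_process_def)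
    then have H: "?H = 1 - exp (- c / z)" using prob_path_sup_le [OF rep z] by simp
    have H0: "?H > 0" unfolding H using c z by simp
    have "?f z - ?q = (?A - ?q * ?H) / ?H"
      unfolding f using H0 by (simp add: diff_divide_distrib)
    then have "\<bar>?f z - ?q\<bar> = \<bar>?A - ?q * ?H\<bar> / ?H"
      using H0 by simp
    also have "\<dots> \<le> (c / (\<epsilon> * z))\<^sup>2 / ?H"
      using spectral_tail_error [OF rep y \<epsilon> \<epsilon>w z] H0 by (intro divide_right_mono) auto
    finally show ?thesis unfolding H .
  qed
  \<comment> \<open>The numerator is of order 1/z^2 and the denominator is asymptotic to c/z, so the
    quotient decays like 1/z for the fixed \<epsilon>.\<close>
  have "((\<lambda>z. (c / (\<epsilon> * z))\<^sup>2 / (1 - exp (- c / z))) \<longlongrightarrow> 0) at_top"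
    using c \<epsilon>(1) by real_asymp
  then have "((\<lambda>z. ?f z - ?q) \<longlongrightarrow> 0) at_top"
    by (rule Lim_null_comparison [rotated])
       (use bound in \<open>auto intro: eventually_mono [OF eventually_gt_at_top [of 0]]\<close>)
  then show "(?f \<longlongrightarrow> ?q) at_top" by (rule LIM_zero_cancel)
qed

end
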